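(* Let $0<\varrho\le 1$ and $0\le u\le 1/2$. Then $$C(u,u;\varrho)\ \le\ 2u\cdot g\left(\frac{u}{2};\varrho\right).$$ The bound is tight (i.e. holds with equality) for $\varrho=0$ (where the same expressions are considered with $\varrho=0$), for $\varrho=1$, or for $u=0$. The maximum over $\varrho$ and $u\in[0,1/2]$ of the error $2u\,g(u/2;\varrho)-C(u,u;\varrho)$ is attained for $u=1/2$ and $\varrho$ satisfying $$-\frac{1+\varrho}{2\pi\cdot\Phi^{-1}\left(\frac14\right)}=\varphi\left(\sqrt{\frac{1-\varrho}{1+\varrho}}\cdot\Phi^{-1}\left(\tfrac14\right)\right),$$ i.e. $\varrho\approx 0.5961$, the value of the maximum error being approximately $0.015$.
   Context: $\varphi(x)=\frac{1}{\sqrt{2\pi}}e^{-x^2/2}$ and $\Phi(h)=\int_{-\infty}^h\varphi(x)\,dx$ are the standard normal density and distribution function. For $\varrho\in(-1,1)$, $$\varphi_2(x,y;\varrho)=\frac{1}{2\pi\sqrt{1-\varrho^2}}\exp\left(-\frac{x^2-2\varrho xy+y^2}{2(1-\varrho^2)}\right),\qquad \Phi_2(h,k;\varrho)=\int_{-\infty}^h\int_{-\infty}^k\varphi_2(x,y;\varrho)\,dy\,dx,$$ and the bivariate normal copula is $C(u,v;\varrho)=\Phi_2(\Phi^{-1}(u),\Phi^{-1}(v);\varrho)$ for $u,v\in(0,1)$, extended continuously to $[0,1]^2$ (so $C(0,v;\varrho)=C(u,0;\varrho)=0$). For $\varrho=1$ it is defined by the limit $\varrho\to1$: $C(u,v;1)=\min(u,v)$.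 For $\varrho\in(-1,1]$ and $u\in(0,1)$, $$g(u;\varrho):=\Phi\left(\sqrt{\frac{1-\varrho}{1+\varrho}}\cdot\Phi^{-1}(u)\right).$$ At $u=0$, $g(0;\varrho)$ is the limit $u\to0^+$ of $g(u;\varrho)$ (it equals $0$ for $\varrho<1$); in any case $2u\cdot g(u/2;\varrho)$ is $0$ at $u=0$. *)

theory Defs
  imports "HOL-Probability.Probability"
begin

definition Phi :: "real \<Rightarrow> real" where
  "Phi h = (LBINT x:{..h}. std_normal_density x)"

text \<open>\<open>Phi\<close> is injective with range \<open>(0,1)\<close>, so \<open>Phi_inv u\<close> is meaningful
  exactly for \<open>0 < u < 1\<close> and is only ever used there.\<close>

definition Phi_inv :: "real \<Rightarrow> real" where
  "Phi_inv = inv Phi"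

definition bvn_density :: "real \<Rightarrow> real \<Rightarrow> real \<Rightarrow> real" where
  "bvn_density x y \<rho> =
     1 / (2 * pi * sqrt (1 - \<rho>\<^sup>2)) * exp (- ((x\<^sup>2 - 2 * \<rho> * x * y + y\<^sup>2) / (2 * (1 - \<rho>\<^sup>2))))"

definition Phi2 :: "real \<Rightarrow> real \<Rightarrow> real \<Rightarrow> real" where
  "Phi2 h k \<rho> = (LBINT x:{..h}. (LBINT y:{..k}. bvn_density x y \<rho>))"

text \<open>The copula for \<open>-1 < \<rho> < 1\<close>: explicit on the open unit square, and
  on the boundary the continuous extension, i.e. the limit from inside the open square.\<close>

definition bvn_copula_nondeg :: "real \<Rightarrow> real \<Rightarrow> real \<Rightarrow> real" where
  "bvn_copula_nondeg u v \<rho> =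
     (if u \<in> {0<..<1} \<and> v \<in> {0<..<1} then Phi2 (Phi_inv u) (Phi_inv v) \<rho>
      else Lim (at (u, v) within {0<..<1} \<times> {0<..<1})
             (\<lambda>(s, t). Phi2 (Phi_inv s) (Phi_inv t) \<rho>))"

text \<open>For \<open>\<rho> = 1\<close> the density degenerates and the copula is the limit \<open>\<rho> \<rightarrow> 1\<close>,
  which is \<open>min u v\<close>.\<close>

definition bvn_copula :: "real \<Rightarrow> real \<Rightarrow> real \<Rightarrow> real" where
  "bvn_copula u v \<rho> =
     (if \<rho> = 1 then Lim (at_left 1) (\<lambda>r. bvn_copula_nondeg u v r)
      else bvn_copula_nondeg u v \<rho>)"

text \<open>For \<open>-1 < \<rho> \<le> 1\<close> and \<open>0 \<le> u < 1\<close>; the value at \<open>u = 0\<close> is the right-hand limit.\<close>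

definition bvn_g :: "real \<Rightarrow> real \<Rightarrow> real" where
  "bvn_g u \<rho> =
     (if u = 0 then Lim (at_right 0) (\<lambda>t. Phi (sqrt ((1 - \<rho>) / (1 + \<rho>)) * Phi_inv t))
      else Phi (sqrt ((1 - \<rho>) / (1 + \<rho>)) * Phi_inv u))"

definition bound_error :: "real \<Rightarrow> real \<Rightarrow> real" where
  "bound_error u \<rho> = 2 * u * bvn_g (u / 2) \<rho> - bvn_copula u u \<rho>"

definition critical_corr :: "real \<Rightarrow> bool" where
  "critical_corr \<rho> \<longleftrightarrow>
     - ((1 + \<rho>) / (2 * pi * Phi_inv (1 / 4)))
       = std_normal_density (sqrt ((1 - \<rho>) / (1 + \<rho>)) * Phi_inv (1 / 4))"

end

(*
  With h the u-quantile of the standard normal law and a = sqrt ((1 - rho) / (1 + rho)), splitting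
  the quadrant {x <= h, y <= h} along its diagonal gives
    C(u,u;rho) = 2 * integral over x <= h of phi(x) Phi(a x),
  so that C(u,u;rho) is twice the integral of g(.;rho) over [0,u], and 2 u g(u/2;rho) is the midpoint
  approximation. Since g is concave on [0,1/2], the midpoint error is nonnegative and increasing in u.
  At u = 1/2 the error is F(a) = 1/2 - Phi(a q) + arctan a / pi with q the upper quartile, and the
  sign of F'(a) is that of c - (1 + s) exp (- s q^2 / 2) for s = a^2 and c = sqrt (2 pi) / (pi q).
  As (1 + s) exp (- s q^2 / 2) increases on [0,1], F has a single maximum; truncated alternating
  series locate it.
*)

theory Submission
  imports Defs
begin

section \<open>The standard normal distribution function\<close>

text \<open>Working with a instead of rho absorbs the degenerate case: the copula at rho = 1 exists
  only as a limit, yet it corresponds to the ordinary value a = 0, and 0 \<le> rho \<le> 1 means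
  exactly 0 \<le> a \<le> 1. The restriction a \<le> 1 is what makes g concave: at the point with
  quantile z its slope is a exp ((1 - a^2) z^2 / 2), which does not increase as z rises to 0. At u =
  0 the copula is again a limit, so the sign of the error for u > 0 is obtained by following the
  monotone error down towards 0, where it is at least -2u. The arctangent is an angle: at u = 1/2
  the integral is the probability of a planar wedge under the rotation-invariant normal law. Since
  the error increases in u for each fixed a, the maximum over two variables becomes one over a
  alone. The accuracy of q is dictated by the location of the maximum: four digits of rho call for a
  bracket of width 5e-7, whereas the size of the error needs only coarse estimates.\<close>

lemma set_integral_atMost_has_real_derivative:
  fixes f :: "real \<Rightarrow> real"
  assumes int: "integrable lborel f" and cont: "continuous_on UNIV f"
  shows "((\<lambda>h. LBINT x:{..h}. f x) has_real_derivative f h) (at h)"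
proof -
  \<comment> \<open>The fundamental theorem needs a compact interval: for arguments near
    \<open>h\<close> only the part above \<open>a\<close> varies, and the tail below it is
    constant.\<close>
  define a where "a = h - 1"
  have si: "set_integrable lborel A f" if "A \<in> sets borel" for A
    using that int unfolding set_integrable_def by (intro integrable_mult_indicator) auto
  have eq: "(LBINT x:{..t}. f x) = (LBINT x:{..<a}. f x) + integral {a..t} f"
    if "a \<le> t" for t
  proof -
    have "{..t} = {..<a} \<union> {a..t}" using that by auto
    then have "(LBINT x:{..t}. f x) = (LBINT x:{..<a}. f x) + (LBINT x:{a..t}. f x)"
      using set_integral_Un[OF _ si si, of "{..<a}" "{a..t}"] by (auto simp: disjoint_iff)
    then show ?thesis using set_borel_integral_eq_integral(2)[of "{a..t}" f] si by simp
  qed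
  have "((\<lambda>x. integral {a..x} f) has_real_derivative f h) (at h within {a..h+1})"
    by (rule integral_has_real_derivative) (auto simp: a_def intro: continuous_on_subset[OF cont])
  then have "((\<lambda>x. integral {a..x} f) has_real_derivative f h) (at h within {a<..<h+1})"
    by (rule DERIV_subset) auto
  then have "((\<lambda>x. integral {a..x} f) has_real_derivative f h) (at h)"
    by (subst (asm) at_within_open) (auto simp: a_def)
  then have *: "((\<lambda>x. (LBINT x:{..<a}. f x) + integral {a..x} f) has_real_derivative f h) (at h)"
    by (auto intro!: derivative_eq_intros)
  show ?thesis
    by (rule has_field_derivative_transform_within_open[OF *, of "{a<..<h+1}"])
       (auto simp: a_def eq)
qed

abbreviation phi :: "real \<Rightarrow> real" where
  "phi \<equiv> std_normal_density"

lemma phi_pos: "0 < phi x"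
  by (simp add: normal_density_pos)

lemma phi_minus: "phi (- x) = phi x"
  by (simp add: std_normal_density_def)

lemma continuous_on_phi: "continuous_on A phi"
  unfolding normal_density_def[abs_def] by (intro continuous_intros) auto

lemma set_integrable_phi: "A \<in> sets borel \<Longrightarrow> set_integrable lborel A phi"
  unfolding set_integrable_def by (intro integrable_mult_indicator) auto

lemma Phi_has_derivative: "(Phi has_real_derivative phi x) (at x)"
  unfolding Phi_def[abs_def]
  by (rule set_integral_atMost_has_real_derivative) (auto intro: continuous_on_phi)

lemma Phi_has_derivative' [derivative_intros]:
  "(f has_real_derivative f') (at x) \<Longrightarrow>
    ((\<lambda>x. Phi (f x)) has_real_derivative phi (f x) * f') (at x)"
  by (rule DERIV_chain2[OF Phi_has_derivative])

lemma continuous_on_Phi: "continuous_on A Phi"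
  by (meson DERIV_isCont Phi_has_derivative continuous_at_imp_continuous_on)

lemma borel_measurable_Phi [measurable]: "Phi \<in> borel_measurable borel"
  by (intro borel_measurable_continuous_onI continuous_on_Phi)

lemma strict_mono_Phi: "strict_mono Phi"
  by (rule strict_monoI, rule DERIV_pos_imp_increasing[where f = Phi])
     (use Phi_has_derivative phi_pos in blast)+

text \<open>Gives access to the limits and bounds known for distribution functions of real
  distributions.\<close>

lemma Phi_eq_cdf: "Phi = cdf std_normal_distribution"
proof
  fix h
  have "emeasure std_normal_distribution {..h} = ennreal (Phi h)"
    unfolding Phi_def set_lebesgue_integral_def
    using set_integrable_phi[of "{..h}"]
    by (subst emeasure_density, simp, simp, subst nn_integral_eq_integral[symmetric])
       (auto simp: set_integrable_def mult.commute ennreal_mult'' ennreal_indicator)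
  moreover have "0 \<le> Phi h"
    unfolding Phi_def set_lebesgue_integral_def by (intro integral_nonneg_AE) auto
  ultimately show "Phi h = cdf std_normal_distribution h"
    by (simp add: cdf_def measure_def)
qed

lemma Phi_at_bot: "(Phi \<longlongrightarrow> 0) at_bot" and Phi_at_top: "(Phi \<longlongrightarrow> 1) at_top"
proof -
  interpret real_distribution std_normal_distribution by (rule real_dist_normal_dist)
  show "(Phi \<longlongrightarrow> 0) at_bot" "(Phi \<longlongrightarrow> 1) at_top"
    unfolding Phi_eq_cdf by (rule cdf_lim_at_bot cdf_lim_at_top_prob)+
qed

lemma Phi_nonneg: "0 \<le> Phi x"
  unfolding Phi_eq_cdf by (simp add: cdf_def)

lemma Phi_le_1: "Phi x \<le> 1"
proof -
  interpret real_distribution std_normal_distribution by (rule real_dist_normal_dist)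
  show ?thesis unfolding Phi_eq_cdf by (rule cdf_bounded_prob)
qed

lemma Phi_pos: "0 < Phi x" and Phi_less_1: "Phi x < 1"
  using strict_monoD[OF strict_mono_Phi, of "x - 1" x] strict_monoD[OF strict_mono_Phi, of x "x + 1"]
    Phi_nonneg[of "x - 1"] Phi_le_1[of "x + 1"] by simp_all

text \<open>Evenness of the density makes \<open>Phi x + Phi (- x)\<close> constant; its value is
  read off at infinity.\<close>

lemma Phi_minus: "Phi (- x) = 1 - Phi x"
proof -
  have "((\<lambda>x. Phi x + Phi (- x)) has_real_derivative 0) (at x)" for x
    by (auto intro!: derivative_eq_intros simp: phi_minus)
  then have const: "Phi x + Phi (- x) = Phi y + Phi (- y)" for x y
    by (intro DERIV_isconst_all[where f = "\<lambda>x. Phi x + Phi (- x)"]) auto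
  have "((\<lambda>x. Phi x + Phi (- x)) \<longlongrightarrow> 1 + 0) at_top"
    by (intro tendsto_add Phi_at_top filterlim_compose[OF Phi_at_bot] filterlim_uminus_at_bot_at_top)
  moreover have "(\<lambda>y. Phi y + Phi (- y)) = (\<lambda>_. Phi x + Phi (- x))"
    using const by blast
  ultimately have "Phi x + Phi (- x) = 1"
    by (simp add: tendsto_const_iff)
  then show ?thesis by simp
qed

lemma Phi_0 [simp]: "Phi 0 = 1/2"
  using Phi_minus[of 0] by simp

lemma range_Phi: "range Phi = {0<..<1}"
proof -
  have "\<exists>x. Phi x = u" if u: "0 < u" "u < 1" for u
  proof -
    from order_tendstoD(2)[OF Phi_at_bot u(1)] obtain a where a: "Phi a < u"
      using eventually_happens trivial_limit_at_bot_linorder by blast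
    from order_tendstoD(1)[OF Phi_at_top u(2)] obtain b where b: "u < Phi b"
      using eventually_happens trivial_limit_at_top_linorder by blast
    have "a \<le> b" using a b strict_mono_less[OF strict_mono_Phi, of a b] by linarith
    then show ?thesis
      using IVT'[of Phi a u b] a b continuous_on_Phi by auto
  qed
  then show ?thesis using Phi_pos Phi_less_1 by (auto simp: image_iff eq_commute)
qed

lemma Phi_inv_Phi [simp]: "Phi_inv (Phi x) = x"
  unfolding Phi_inv_def by (rule inv_f_f) (rule strict_mono_imp_inj_on[OF strict_mono_Phi])

lemma Phi_Phi_inv: "0 < u \<Longrightarrow> u < 1 \<Longrightarrow> Phi (Phi_inv u) = u"
  unfolding Phi_inv_def by (rule f_inv_into_f) (simp add: range_Phi)

lemma Phi_inv_less_iff: "\<lbrakk>0 < u; u < 1; 0 < v; v < 1\<rbrakk> \<Longrightarrow> Phi_inv u < Phi_inv v \<longleftrightarrow> u < v"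
  using strict_mono_less[OF strict_mono_Phi, of "Phi_inv u" "Phi_inv v"] by (simp add: Phi_Phi_inv)

lemma Phi_inv_half [simp]: "Phi_inv (1/2) = 0"
  using Phi_inv_Phi[of 0] by simp

lemma Phi_inv_nonpos: "0 < u \<Longrightarrow> u \<le> 1/2 \<Longrightarrow> Phi_inv u \<le> 0"
  using Phi_inv_less_iff[of "1/2" u] by simp

lemma Phi_inv_has_derivative:
  assumes "0 < u" "u < 1"
  shows "(Phi_inv has_real_derivative 1 / phi (Phi_inv u)) (at u)"
proof -
  have "isCont Phi_inv (Phi (Phi_inv u))"
    by (rule isCont_inverse_function[where d = 1])
       (auto intro: DERIV_isCont Phi_has_derivative)
  then have "isCont Phi_inv u" by (simp add: Phi_Phi_inv assms)
  then show ?thesis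
    using DERIV_inverse_function[of Phi "phi (Phi_inv u)" Phi_inv u 0 1]
      Phi_has_derivative phi_pos[of "Phi_inv u"] assms
    by (simp add: Phi_Phi_inv inverse_eq_divide)
qed

section \<open>The bivariate distribution function on the diagonal\<close>

lemma integrable_phi_times_Phi:
  assumes [measurable]: "f \<in> borel_measurable borel"
  shows "integrable lborel (\<lambda>x. phi x * Phi (f x))"
proof (rule Bochner_Integration.integrable_bound[OF integrable_normal_density])
  show "AE x in lborel. norm (phi x * Phi (f x)) \<le> norm (phi x)"
    by (auto simp: abs_mult Phi_nonneg intro!: mult_left_le Phi_le_1)
qed measurable

lemma nn_integral_normal_density_atMost:
  assumes \<sigma>: "0 < \<sigma>"
  shows "(\<integral>\<^sup>+y. ennreal (normal_density m \<sigma> y) * indicator {..k} y \<partial>lborel)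
    = ennreal (Phi ((k - m) / \<sigma>))"
proof -
  have "(\<integral>\<^sup>+y. ennreal (normal_density m \<sigma> y) * indicator {..k} y \<partial>lborel)
      = \<bar>\<sigma>\<bar> * (\<integral>\<^sup>+y. ennreal (normal_density m \<sigma> (m + \<sigma> * y)) * indicator {..k} (m + \<sigma> * y) \<partial>lborel)"
    by (subst nn_integral_real_affine[where c = \<sigma> and t = m]) (use \<sigma> in auto)
  also have "\<dots> = (\<integral>\<^sup>+y. \<bar>\<sigma>\<bar> * (ennreal (normal_density m \<sigma> (m + \<sigma> * y)) * indicator {..k} (m + \<sigma> * y)) \<partial>lborel)"
    by (subst nn_integral_cmult) auto
  also have "\<dots> = (\<integral>\<^sup>+y. ennreal (indicator {..(k - m) / \<sigma>} y *\<^sub>R phi y) \<partial>lborel)"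
  proof (intro nn_integral_cong)
    fix y
    have "\<sigma> * normal_density m \<sigma> (m + \<sigma> * y) = phi y"
      using \<sigma> by (simp add: normal_density_def real_sqrt_mult power_mult_distrib)
    moreover have "m + \<sigma> * y \<le> k \<longleftrightarrow> y \<le> (k - m) / \<sigma>"
      using \<sigma> by (simp add: field_simps)
    ultimately show "\<bar>\<sigma>\<bar> * (ennreal (normal_density m \<sigma> (m + \<sigma> * y)) * indicator {..k} (m + \<sigma> * y))
      = ennreal (indicator {..(k - m) / \<sigma>} y *\<^sub>R phi y)"
      using \<sigma> by (auto simp: indicator_def ennreal_mult[symmetric])
  qed
  also have "\<dots> = ennreal (Phi ((k - m) / \<sigma>))"
    unfolding Phi_def set_lebesgue_integral_def
    by (rule nn_integral_eq_integral)
       (use set_integrable_phi[of "{..(k - m) / \<sigma>}"] in \<open>auto simp: set_integrable_def\<close>)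
  finally show ?thesis .
qed

text \<open>Completing the square in \<open>y\<close>: given the first coordinate \<open>x\<close>,
  the second is normal with mean \<open>\<rho> * x\<close> and variance
  \<open>1 - \<rho>\<^sup>2\<close>.\<close>

lemma bvn_density_eq:
  assumes "\<bar>\<rho>\<bar> < 1"
  shows "bvn_density x y \<rho> = phi x * normal_density (\<rho> * x) (sqrt (1 - \<rho>\<^sup>2)) y"
proof -
  have "\<rho>\<^sup>2 < 1" using assms by (simp add: abs_square_less_1)
  then have pos: "1 - \<rho>\<^sup>2 > 0" by simp
  have "- ((x\<^sup>2 - 2 * \<rho> * x * y + y\<^sup>2) / (2 * (1 - \<rho>\<^sup>2)))
      = - x\<^sup>2 / 2 + - (y - \<rho> * x)\<^sup>2 / (2 * (1 - \<rho>\<^sup>2))"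
    using pos by (simp add: divide_simps) (simp add: algebra_simps power2_eq_square)
  moreover have "sqrt (2 * pi) * sqrt (2 * pi * (1 - \<rho>\<^sup>2)) = 2 * pi * sqrt (1 - \<rho>\<^sup>2)"
    using real_sqrt_mult[of "2 * pi" "1 - \<rho>\<^sup>2"] by simp
  ultimately show ?thesis
    using pos by (simp add: bvn_density_def normal_density_def exp_add[symmetric] mult.assoc)
qed

lemma bvn_density_nonneg: "\<bar>\<rho>\<bar> < 1 \<Longrightarrow> 0 \<le> bvn_density x y \<rho>"
  by (simp add: bvn_density_eq)

lemma bvn_density_commute: "bvn_density x y \<rho> = bvn_density y x \<rho>"
  by (simp add: bvn_density_def algebra_simps)

lemma borel_measurable_bvn_density [measurable]:
  "(\<lambda>(x, y). bvn_density x y \<rho>) \<in> borel_measurable (borel \<Otimes>\<^sub>M borel)"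
  unfolding bvn_density_def by measurable

text \<open>Kept as a nonnegative extended integral so that the order of integration can later be
  exchanged by Tonelli.\<close>

lemma nn_integral_bvn_density_atMost:
  assumes "\<bar>\<rho>\<bar> < 1"
  shows "(\<integral>\<^sup>+y. ennreal (bvn_density x y \<rho>) * indicator {..k} y \<partial>lborel)
    = ennreal (phi x * Phi ((k - \<rho> * x) / sqrt (1 - \<rho>\<^sup>2)))"
proof -
  have "0 < sqrt (1 - \<rho>\<^sup>2)" using assms by (simp add: abs_square_less_1)
  note * = nn_integral_normal_density_atMost[OF this, of "\<rho> * x" k]
  have "(\<integral>\<^sup>+y. ennreal (bvn_density x y \<rho>) * indicator {..k} y \<partial>lborel)
      = (\<integral>\<^sup>+y. ennreal (phi x) * (ennreal (normal_density (\<rho> * x) (sqrt (1 - \<rho>\<^sup>2)) y) * indicator {..k} y) \<partial>lborel)"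
    using assms by (simp add: bvn_density_eq ennreal_mult mult.assoc)
  also have "\<dots> = ennreal (phi x) * ennreal (Phi ((k - \<rho> * x) / sqrt (1 - \<rho>\<^sup>2)))"
    by (subst nn_integral_cmult) (auto simp: *)
  finally show ?thesis by (simp add: ennreal_mult Phi_nonneg)
qed

lemma Phi2_eq_integral_conditional:
  assumes "\<bar>\<rho>\<bar> < 1"
  shows "Phi2 h k \<rho> = (LBINT x:{..h}. phi x * Phi ((k - \<rho> * x) / sqrt (1 - \<rho>\<^sup>2)))"
proof -
  have "(LBINT y:{..k}. bvn_density x y \<rho>) = phi x * Phi ((k - \<rho> * x) / sqrt (1 - \<rho>\<^sup>2))" for x
    unfolding set_lebesgue_integral_def
  proof (subst integral_eq_nn_integral)
    have "(\<integral>\<^sup>+ y. ennreal (indicat_real {..k} y *\<^sub>R bvn_density x y \<rho>) \<partial>lborel)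
      = (\<integral>\<^sup>+y. ennreal (bvn_density x y \<rho>) * indicator {..k} y \<partial>lborel)"
      by (intro nn_integral_cong) (auto simp: indicator_def)
    then show "enn2real (\<integral>\<^sup>+ y. ennreal (indicat_real {..k} y *\<^sub>R bvn_density x y \<rho>) \<partial>lborel)
      = phi x * Phi ((k - \<rho> * x) / sqrt (1 - \<rho>\<^sup>2))"
      by (simp add: nn_integral_bvn_density_atMost assms Phi_nonneg)
  qed (auto simp: bvn_density_nonneg assms)
  then show ?thesis unfolding Phi2_def by simp
qed

lemma nn_integral_phi_Phi:
  assumes [measurable]: "f \<in> borel_measurable borel"
  shows "(\<integral>\<^sup>+x. ennreal (phi x * Phi (f x)) * indicator {..h} x \<partial>lborel)
    = ennreal (LBINT x:{..h}. phi x * Phi (f x))"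
proof -
  have "(\<integral>\<^sup>+x. ennreal (phi x * Phi (f x)) * indicator {..h} x \<partial>lborel)
    = (\<integral>\<^sup>+x. ennreal (indicator {..h} x *\<^sub>R (phi x * Phi (f x))) \<partial>lborel)"
    by (intro nn_integral_cong) (auto simp: indicator_def)
  also have "\<dots> = ennreal (LBINT x:{..h}. phi x * Phi (f x))"
    unfolding set_lebesgue_integral_def
    by (intro nn_integral_eq_integral integrable_mult_indicator integrable_phi_times_Phi)
       (auto simp: Phi_nonneg)
  finally show ?thesis .
qed

lemma phi_Phi_integral_bounds:
  assumes [measurable]: "f \<in> borel_measurable borel"
  shows "0 \<le> (LBINT x:{..h}. phi x * Phi (f x))" "(LBINT x:{..h}. phi x * Phi (f x)) \<le> Phi h"
proof -
  have i: "set_integrable lborel {..h} (\<lambda>x. phi x * Phi (f x))"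
    unfolding set_integrable_def
    by (intro integrable_mult_indicator integrable_phi_times_Phi) auto
  show "0 \<le> (LBINT x:{..h}. phi x * Phi (f x))"
    unfolding set_lebesgue_integral_def
    by (intro integral_nonneg_AE) (auto simp: Phi_nonneg)
  show "(LBINT x:{..h}. phi x * Phi (f x)) \<le> Phi h"
    unfolding Phi_def[of h]
    by (intro set_integral_mono i set_integrable_phi) (auto intro!: mult_left_le Phi_le_1)
qed

lemma Phi2_bounds:
  assumes "\<bar>\<rho>\<bar> < 1"
  shows "0 \<le> Phi2 h k \<rho>" "Phi2 h k \<rho> \<le> Phi h"
  unfolding Phi2_eq_integral_conditional[OF assms]
  by (intro phi_Phi_integral_bounds; measurable)+

text \<open>For independent standard normal X, Y this is P(X \<le> h, Y \<le> a X); twice it is the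
  skew-normal distribution function with shape \<open>a\<close>.\<close>

definition phi_Phi_integral :: "real \<Rightarrow> real \<Rightarrow> real" where
  "phi_Phi_integral a h = (LBINT x:{..h}. phi x * Phi (a * x))"

lemma Phi2_diagonal:
  assumes \<rho>: "\<bar>\<rho>\<bar> < 1"
  shows "Phi2 h h \<rho> = 2 * phi_Phi_integral (sqrt ((1 - \<rho>) / (1 + \<rho>))) h"
proof -
  let ?f = "\<lambda>x y. ennreal (bvn_density x y \<rho>)"
  \<comment> \<open>With inner bound \<open>k = x\<close> the conditional argument becomes linear in
    \<open>x\<close>; its slope is the origin of the ratio under the root.\<close>
  have a: "(x - \<rho> * x) / sqrt (1 - \<rho>\<^sup>2) = sqrt ((1 - \<rho>) / (1 + \<rho>)) * x" for x
  proof -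
    have "1 - \<rho>\<^sup>2 = (1 - \<rho>) * (1 + \<rho>)" by (simp add: power2_eq_square algebra_simps)
    moreover have "(1 - \<rho>) / sqrt (1 - \<rho>) = sqrt (1 - \<rho>)"
      using \<rho> by (simp add: real_div_sqrt)
    ultimately show ?thesis
      using \<rho> by (simp add: real_sqrt_mult real_sqrt_divide divide_simps) (simp add: algebra_simps)
  qed
  have lower: "(\<integral>\<^sup>+x. (\<integral>\<^sup>+y. ?f x y * indicator {..x} y \<partial>lborel) * indicator {..h} x \<partial>lborel)
      = ennreal (phi_Phi_integral (sqrt ((1 - \<rho>) / (1 + \<rho>))) h)"
    unfolding nn_integral_bvn_density_atMost[OF \<rho>] a phi_Phi_integral_def
    by (rule nn_integral_phi_Phi) simp
  have "ennreal (Phi2 h h \<rho>)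
      = (\<integral>\<^sup>+x. (\<integral>\<^sup>+y. ?f x y * indicator {..h} y \<partial>lborel) * indicator {..h} x \<partial>lborel)"
    unfolding Phi2_eq_integral_conditional[OF \<rho>] nn_integral_bvn_density_atMost[OF \<rho>]
    by (rule nn_integral_phi_Phi[symmetric]) simp
  also have "\<dots> = (\<integral>\<^sup>+x. (\<integral>\<^sup>+y. ?f x y * indicator {y. y \<le> h \<and> x \<le> h} y \<partial>lborel) \<partial>lborel)"
    by (intro nn_integral_cong, subst nn_integral_multc[symmetric])
       (auto simp: indicator_def intro!: nn_integral_cong)
  also have "\<dots> = (\<integral>\<^sup>+x. (\<integral>\<^sup>+y. ?f x y * indicator {y. y \<le> x \<and> x \<le> h} y \<partial>lborel)
      + (\<integral>\<^sup>+y. ?f x y * indicator {y. x \<le> y \<and> y \<le> h} y \<partial>lborel) \<partial>lborel)"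
  proof (intro nn_integral_cong)
    fix x :: real
    have "(\<integral>\<^sup>+y. ?f x y * indicator {y. y \<le> h \<and> x \<le> h} y \<partial>lborel)
      = (\<integral>\<^sup>+y. ?f x y * indicator {y. y \<le> x \<and> x \<le> h} y
          + ?f x y * indicator {y. x \<le> y \<and> y \<le> h} y \<partial>lborel)"
      \<comment> \<open>The two halves overlap only in \<open>y = x\<close>, a null set for each
        fixed \<open>x\<close>.\<close>
      using AE_lborel_singleton[of x]
      by (intro nn_integral_cong_AE) (auto elim!: eventually_mono simp: indicator_def)
    then show "(\<integral>\<^sup>+y. ?f x y * indicator {y. y \<le> h \<and> x \<le> h} y \<partial>lborel)
      = (\<integral>\<^sup>+y. ?f x y * indicator {y. y \<le> x \<and> x \<le> h} y \<partial>lborel)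
      + (\<integral>\<^sup>+y. ?f x y * indicator {y. x \<le> y \<and> y \<le> h} y \<partial>lborel)"
      by (subst (asm) nn_integral_add) auto
  qed
  also have "\<dots> = (\<integral>\<^sup>+x. (\<integral>\<^sup>+y. ?f x y * indicator {y. y \<le> x \<and> x \<le> h} y \<partial>lborel) \<partial>lborel)
      + (\<integral>\<^sup>+x. (\<integral>\<^sup>+y. ?f x y * indicator {y. x \<le> y \<and> y \<le> h} y \<partial>lborel) \<partial>lborel)"
    by (rule nn_integral_add) (simp_all add: indicator_def cong: measurable_cong)
  \<comment> \<open>Exchanging the order and using the symmetry of the density maps the upper half
    onto the lower one.\<close>
  also have "(\<integral>\<^sup>+x. (\<integral>\<^sup>+y. ?f x y * indicator {y. x \<le> y \<and> y \<le> h} y \<partial>lborel) \<partial>lborel)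
      = (\<integral>\<^sup>+y. (\<integral>\<^sup>+x. ?f x y * indicator {y. x \<le> y \<and> y \<le> h} y \<partial>lborel) \<partial>lborel)"
    by (subst lborel_pair.Fubini') (simp_all add: indicator_def split_beta')
  also have "\<dots> = (\<integral>\<^sup>+x. (\<integral>\<^sup>+y. ?f x y * indicator {y. y \<le> x \<and> x \<le> h} y \<partial>lborel) \<partial>lborel)"
    by (simp add: bvn_density_commute[of _ _ \<rho>] indicator_def)
  also have "\<dots> = (\<integral>\<^sup>+x. (\<integral>\<^sup>+y. ?f x y * indicator {..x} y \<partial>lborel) * indicator {..h} x \<partial>lborel)"
    by (intro nn_integral_cong, subst nn_integral_multc[symmetric])
       (auto simp: indicator_def intro!: nn_integral_cong)
  finally have "ennreal (Phi2 h h \<rho>) = ennreal (2 * phi_Phi_integral (sqrt ((1 - \<rho>) / (1 + \<rho>))) h)"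
    unfolding lower using phi_Phi_integral_bounds(1)[of "\<lambda>x. sqrt ((1 - \<rho>) / (1 + \<rho>)) * x" h]
    by (simp add: phi_Phi_integral_def ennreal_plus[symmetric] del: ennreal_plus)
  then show ?thesis
    using phi_Phi_integral_bounds(1)[of "\<lambda>x. sqrt ((1 - \<rho>) / (1 + \<rho>)) * x" h] Phi2_bounds(1)[OF \<rho>]
    by (simp add: phi_Phi_integral_def)
qed

section \<open>The integral of phi(x) Phi(a x)\<close>

lemma phi_Phi_integral_has_derivative:
  "(phi_Phi_integral a has_real_derivative phi h * Phi (a * h)) (at h)"
  unfolding phi_Phi_integral_def[abs_def]
proof (rule set_integral_atMost_has_real_derivative)
  show "integrable lborel (\<lambda>x. phi x * Phi (a * x))"
    by (rule integrable_phi_times_Phi) simp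
  show "continuous_on UNIV (\<lambda>x. phi x * Phi (a * x))"
    by (intro continuous_intros continuous_on_phi continuous_on_compose2[OF continuous_on_Phi[of UNIV]]) auto
qed

lemma phi_Phi_integral_nonneg: "0 \<le> phi_Phi_integral a h"
  and phi_Phi_integral_le: "phi_Phi_integral a h \<le> Phi h"
  unfolding phi_Phi_integral_def by (rule phi_Phi_integral_bounds; simp)+

lemma phi_Phi_integral_at_bot: "(phi_Phi_integral a \<longlongrightarrow> 0) at_bot"
  by (rule tendsto_sandwich[OF _ _ tendsto_const Phi_at_bot])
     (simp_all add: phi_Phi_integral_nonneg phi_Phi_integral_le)

text \<open>The case \<rho> = 0: the integrand is the derivative of
  \<open>(Phi h)\<^sup>2 / 2\<close>, and the constant is fixed at minus infinity.\<close>

lemma phi_Phi_integral_1: "phi_Phi_integral 1 h = (Phi h)\<^sup>2 / 2"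
proof -
  let ?d = "\<lambda>h. phi_Phi_integral 1 h - (Phi h)\<^sup>2 / 2"
  have "(?d has_real_derivative 0) (at x)" for x
    by (auto intro!: derivative_eq_intros phi_Phi_integral_has_derivative)
  then have const: "?d x = ?d y" for x y
    by (intro DERIV_isconst_all[where f = ?d]) auto
  have "(?d \<longlongrightarrow> 0 - 0\<^sup>2 / 2) at_bot"
    by (intro tendsto_intros phi_Phi_integral_at_bot Phi_at_bot) auto
  moreover have "?d = (\<lambda>_. ?d h)" using const by blast
  ultimately have "?d h = 0" by (simp add: tendsto_const_iff)
  then show ?thesis by simp
qed

lemma phi_le_1: "phi x \<le> 1"
proof -
  have "1 \<le> sqrt (2 * pi)" using pi_gt3 by (intro real_le_rsqrt) simp
  moreover have "exp (- x\<^sup>2 / 2) \<le> 1" by simp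
  ultimately have "exp (- x\<^sup>2 / 2) / sqrt (2 * pi) \<le> 1 / 1"
    by (intro frac_le) auto
  then show ?thesis by (simp add: std_normal_density_def)
qed

lemma Phi_lipschitz: "\<bar>Phi x - Phi y\<bar> \<le> \<bar>x - y\<bar>"
  using field_differentiable_bound[of UNIV Phi phi 1 x y] Phi_has_derivative
  by (simp add: phi_le_1 has_field_derivative_at_within)

text \<open>Controls the limit \<rho> \<rightarrow> 1, that is, \<open>a\<close> tending to 0:
  \<open>Phi (a * x)\<close> differs from \<open>1/2\<close> by at most
  \<open>\<bar>a\<bar> * \<bar>x\<bar>\<close>, and the first absolute moment is finite.\<close>

lemma phi_Phi_integral_near_0:
  "\<bar>phi_Phi_integral a h - Phi h / 2\<bar> \<le> \<bar>a\<bar> * (\<integral>x. phi x * \<bar>x\<bar> \<partial>lborel)"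
proof -
  have i: "set_integrable lborel {..h} (\<lambda>x. phi x * Phi (a * x))"
    unfolding set_integrable_def
    by (intro integrable_mult_indicator integrable_phi_times_Phi) auto
  have m: "integrable lborel (\<lambda>x. phi x * \<bar>x\<bar>)"
    using integrable_std_normal_moment_abs[of 1] by simp
  have d: "integrable lborel (\<lambda>x. indicator {..h} x *\<^sub>R (phi x * Phi (a * x) - phi x / 2))"
    using set_integral_diff(1)[OF i, of "\<lambda>x. phi x / 2"] set_integrable_phi[of "{..h}"]
    by (auto simp: set_integrable_def)
  have pt: "norm (indicator {..h} x *\<^sub>R (phi x * Phi (a * x) - phi x / 2)) \<le> \<bar>a\<bar> * (phi x * \<bar>x\<bar>)" for x
  proof -
    have "\<bar>Phi (a * x) - 1/2\<bar> \<le> \<bar>a\<bar> * \<bar>x\<bar>"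
      using Phi_lipschitz[of "a * x" 0] by (simp add: abs_mult)
    then have "phi x * \<bar>Phi (a * x) - 1/2\<bar> \<le> phi x * (\<bar>a\<bar> * \<bar>x\<bar>)"
      by (intro mult_left_mono) auto
    moreover have "phi x * Phi (a * x) - phi x / 2 = phi x * (Phi (a * x) - 1/2)"
      by (simp add: algebra_simps)
    ultimately show ?thesis
      by (auto simp: indicator_def abs_mult mult_ac)
  qed
  have "phi_Phi_integral a h - Phi h / 2
      = (LBINT x:{..h}. phi x * Phi (a * x)) - (LBINT x:{..h}. phi x / 2)"
    by (simp add: phi_Phi_integral_def Phi_def)
  also have "\<dots> = (LBINT x:{..h}. phi x * Phi (a * x) - phi x / 2)"
    using i set_integrable_phi[of "{..h}"] by (subst set_integral_diff(2)) auto
  also have "\<bar>\<dots>\<bar> \<le> (\<integral>x. \<bar>a\<bar> * (phi x * \<bar>x\<bar>) \<partial>lborel)"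
    using Bochner_Integration.integral_norm_bound_integral[OF d _ pt] m
    by (simp add: set_lebesgue_integral_def)
  also have "\<dots> = \<bar>a\<bar> * (\<integral>x. phi x * \<bar>x\<bar> \<partial>lborel)" by simp
  finally show ?thesis .
qed

text \<open>Slope coordinates \<open>y = - (x * t)\<close> replace the moving limit
  \<open>- (a * x)\<close> by the fixed limit \<open>a\<close>, so that the region of the double
  integral becomes a product.\<close>

lemma nn_integral_phi_scaled_tail:
  assumes "0 < x"
  shows "ennreal (Phi (- (a * x))) = (\<integral>\<^sup>+t. ennreal (x * phi (x * t)) * indicator {a..} t \<partial>lborel)"
proof -
  have "ennreal (Phi (- (a * x))) = (\<integral>\<^sup>+y. ennreal (phi y) * indicator {..- (a * x)} y \<partial>lborel)"
    using nn_integral_normal_density_atMost[of 1 0 "- (a * x)"] by simp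
  also have "\<dots> = \<bar>- x\<bar> * (\<integral>\<^sup>+t. ennreal (phi (0 + - x * t)) * indicator {..- (a * x)} (0 + - x * t) \<partial>lborel)"
    by (subst nn_integral_real_affine[where c = "- x" and t = 0]) (use assms in auto)
  also have "\<dots> = (\<integral>\<^sup>+t. \<bar>- x\<bar> * (ennreal (phi (0 + - x * t)) * indicator {..- (a * x)} (0 + - x * t)) \<partial>lborel)"
    by (subst nn_integral_cmult) auto
  also have "\<dots> = (\<integral>\<^sup>+t. ennreal (x * phi (x * t)) * indicator {a..} t \<partial>lborel)"
  proof (intro nn_integral_cong)
    fix t
    have "- (x * t) \<le> - (a * x) \<longleftrightarrow> a \<le> t" using assms by simp
    then show "\<bar>- x\<bar> * (ennreal (phi (0 + - x * t)) * indicator {..- (a * x)} (0 + - x * t))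
        = ennreal (x * phi (x * t)) * indicator {a..} t"
      using assms by (auto simp: indicator_def ennreal_mult phi_minus)
  qed
  finally show ?thesis .
qed

text \<open>The substitution \<open>y = x t\<close> makes the angular variable \<open>t\<close> the outer one.\<close>

lemma phi_Phi_integral_at_0: "phi_Phi_integral a 0 = 1/4 - arctan a / (2 * pi)"
proof -
  \<comment> \<open>The Jacobian factor \<open>x\<close> makes the Gaussian integral over
    \<open>x\<close> elementary.\<close>
  have radial: "(\<integral>\<^sup>+x. ennreal (x * phi x * phi (x * t)) * indicator {0..} x \<partial>lborel)
      = ennreal (1 / (2 * pi * (1 + t\<^sup>2)))" for t
  proof -
    let ?F = "\<lambda>x. - exp (- ((1 + t\<^sup>2) / 2 * x\<^sup>2)) / (2 * pi * (1 + t\<^sup>2))"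
    have pos: "1 + t\<^sup>2 > 0" by (simp add: add_pos_nonneg)
    have e: "x * phi x * phi (x * t) = x * exp (- ((1 + t\<^sup>2) / 2 * x\<^sup>2)) / (2 * pi)" for x
    proof -
      have "exp (- ((1 + t\<^sup>2) / 2 * x\<^sup>2)) = exp (- x\<^sup>2 / 2) * exp (- (x * t)\<^sup>2 / 2)"
        by (simp add: exp_add[symmetric] power_mult_distrib algebra_simps add_divide_distrib diff_divide_distrib)
      then show ?thesis by (simp add: std_normal_density_def)
    qed
    have "LIM x at_top. (1 + t\<^sup>2) / 2 * (x::real)\<^sup>2 :> at_top"
      using pos by (intro filterlim_tendsto_pos_mult_at_top[OF tendsto_const] filterlim_pow_at_top filterlim_ident) auto
    then have "((\<lambda>x. exp (- ((1 + t\<^sup>2) / 2 * x\<^sup>2))) \<longlongrightarrow> 0) at_top"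
      by (intro filterlim_compose[OF exp_at_bot] filterlim_compose[OF filterlim_uminus_at_bot_at_top])
    then have "((\<lambda>x. - exp (- ((1 + t\<^sup>2) / 2 * x\<^sup>2)) / (2 * pi * (1 + t\<^sup>2))) \<longlongrightarrow> - 0 / (2 * pi * (1 + t\<^sup>2))) at_top"
      using pos by (intro tendsto_intros) auto
    then have lim: "(?F \<longlongrightarrow> 0) at_top" by simp
    have "(\<integral>\<^sup>+x. ennreal (x * phi x * phi (x * t)) * indicator {0..} x \<partial>lborel) = 0 - ?F 0"
    proof (rule nn_integral_FTC_atLeast[OF _ _ _ lim])
      show "(?F has_real_derivative x * phi x * phi (x * t)) (at x)" for x
      proof -
        let ?E = "exp (- ((1 + t\<^sup>2) / 2 * x\<^sup>2))"
        have "((\<lambda>x. - exp (- ((1 + t\<^sup>2) / 2 * x\<^sup>2))) has_real_derivative (1 + t\<^sup>2) * (x * ?E)) (at x)"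
          by (auto intro!: derivative_eq_intros)
        from DERIV_cdivide[OF this, of "2 * pi * (1 + t\<^sup>2)"] show ?thesis
          unfolding e using pos by (simp add: mult.commute[of "2 * pi"])
      qed
    qed auto
    then show ?thesis by simp
  qed
  have "ennreal (phi_Phi_integral a 0)
      = (\<integral>\<^sup>+x. ennreal (phi x * Phi (a * x)) * indicator {..0} x \<partial>lborel)"
    unfolding phi_Phi_integral_def by (rule nn_integral_phi_Phi[symmetric]) simp
  also have "\<dots> = (\<integral>\<^sup>+x. ennreal (phi x * Phi (- (a * x))) * indicator {0..} x \<partial>lborel)"
    by (subst nn_integral_real_affine[where c = "-1" and t = 0])
       (auto simp: phi_minus indicator_def intro!: nn_integral_cong)
  also have "\<dots> = (\<integral>\<^sup>+x. (\<integral>\<^sup>+t. ennreal (x * phi x * phi (x * t)) * indicator {0..} x * indicator {a..} t \<partial>lborel) \<partial>lborel)"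
  proof (intro nn_integral_cong_AE)
    show "AE x in lborel. ennreal (phi x * Phi (- (a * x))) * indicator {0..} x
      = (\<integral>\<^sup>+t. ennreal (x * phi x * phi (x * t)) * indicator {0..} x * indicator {a..} t \<partial>lborel)"
      \<comment> \<open>The substitution degenerates at \<open>x = 0\<close>, a null set.\<close>
      using AE_lborel_singleton[of 0]
    proof eventually_elim
      fix x :: real assume "x \<noteq> 0"
      then consider "x < 0" | "0 < x" by linarith
      then show "ennreal (phi x * Phi (- (a * x))) * indicator {0..} x
        = (\<integral>\<^sup>+t. ennreal (x * phi x * phi (x * t)) * indicator {0..} x * indicator {a..} t \<partial>lborel)"
      proof cases
        case 2
        then have "ennreal (phi x * Phi (- (a * x)))
          = (\<integral>\<^sup>+t. ennreal (phi x) * (ennreal (x * phi (x * t)) * indicator {a..} t) \<partial>lborel)"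
          by (subst nn_integral_cmult) (auto simp: ennreal_mult Phi_nonneg nn_integral_phi_scaled_tail)
        then show ?thesis
          using 2 by (auto simp: ennreal_mult[symmetric] mult_ac indicator_def intro!: nn_integral_cong)
      qed simp
    qed
  qed
  also have "\<dots> = (\<integral>\<^sup>+t. (\<integral>\<^sup>+x. ennreal (x * phi x * phi (x * t)) * indicator {0..} x * indicator {a..} t \<partial>lborel) \<partial>lborel)"
    by (subst lborel_pair.Fubini') (simp_all add: indicator_def split_beta')
  also have "\<dots> = (\<integral>\<^sup>+t. ennreal (1 / (2 * pi * (1 + t\<^sup>2))) * indicator {a..} t \<partial>lborel)"
    by (subst nn_integral_multc) (simp_all add: radial)
  also have "\<dots> = (pi / 2) / (2 * pi) - arctan a / (2 * pi)"
  proof (rule nn_integral_FTC_atLeast)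
    show "((\<lambda>t. arctan t / (2 * pi)) has_real_derivative 1 / (2 * pi * (1 + t\<^sup>2))) (at t)" for t
      using DERIV_cdivide[OF DERIV_arctan[of t], of "2 * pi"]
      by (simp add: inverse_eq_divide mult.commute[of "2 * pi"])
    show "((\<lambda>t. arctan t / (2 * pi)) \<longlongrightarrow> (pi / 2) / (2 * pi)) at_top"
      by (intro tendsto_intros tendsto_arctan_at_top) auto
  qed (auto simp: add_nonneg_nonneg)
  finally show ?thesis
    \<comment> \<open>\<open>arctan a < pi / 2\<close> makes the right-hand side nonnegative, as
      cancelling \<open>ennreal\<close> requires.\<close>
    using arctan_ubound[of a] phi_Phi_integral_nonneg[of a 0]
    by (subst (asm) ennreal_inj) (auto simp: field_simps)
qed

section \<open>Concavity of g and the midpoint error\<close>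

lemma Phi_scaled_Phi_inv_has_derivative:
  assumes "0 < u" "u < 1"
  shows "((\<lambda>u. Phi (a * Phi_inv u)) has_real_derivative a * exp ((1 - a\<^sup>2) / 2 * (Phi_inv u)\<^sup>2)) (at u)"
proof -
  \<comment> \<open>The slope is a ratio of two normal densities; for
    \<open>0 \<le> a \<le> 1\<close> it is nondecreasing in \<open>\<bar>z\<bar>\<close>, the source
    of concavity below \<open>u = 1/2\<close>.\<close>
  have "phi (a * z) / phi z = exp ((1 - a\<^sup>2) / 2 * z\<^sup>2)" for z
    by (simp add: std_normal_density_def exp_diff[symmetric] power_mult_distrib field_simps)
  then have "phi (a * z) * (a * (1 / phi z)) = a * exp ((1 - a\<^sup>2) / 2 * z\<^sup>2)" for z
    by (metis mult.commute mult.left_commute mult_1 times_divide_eq_right)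
  note this[of "Phi_inv u", symmetric]
  then show ?thesis
    using Phi_inv_has_derivative[OF assms]
    by (auto intro!: derivative_eq_intros)
qed

text \<open>Parametrized by \<open>a\<close>, so that \<rho> = 1 is the regular value
  \<open>a = 0\<close>.\<close>

definition midpoint_error :: "real \<Rightarrow> real \<Rightarrow> real" where
  "midpoint_error a u = 2 * u * Phi (a * Phi_inv (u / 2)) - 2 * phi_Phi_integral a (Phi_inv u)"

text \<open>The slope of \<open>u \<mapsto> \<Phi>(a \<Phi>\<^sup>-\<^sup>1(u))\<close> decreases on \<open>(0, 1/2]\<close>, so this function lies below
  its tangent at \<open>u/2\<close>; that tangent inequality is exactly the sign of the derivative below.\<close>

lemma midpoint_error_mono:
  assumes a: "0 \<le> a" "a \<le> 1" and uv: "0 < u" "u \<le> v" "v \<le> 1/2"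
  shows "midpoint_error a u \<le> midpoint_error a v"
proof (rule DERIV_nonneg_imp_nondecreasing[OF uv(2)])
  fix x assume "u \<le> x" "x \<le> v"
  then have x: "0 < x" "x \<le> 1/2" using uv by auto
  let ?G = "\<lambda>u. Phi (a * Phi_inv u)"
  let ?G' = "\<lambda>u. a * exp ((1 - a\<^sup>2) / 2 * (Phi_inv u)\<^sup>2)"
  let ?D = "2 * ?G (x / 2) + x * ?G' (x / 2) - 2 * ?G x"
  have G: "(?G has_real_derivative ?G' u) (at u)" if "0 < u" "u < 1" for u
    by (rule Phi_scaled_Phi_inv_has_derivative) (use that in auto)
  have "((\<lambda>u. ?G (u / 2)) has_real_derivative ?G' (x / 2) * (1 / 2)) (at x)"
    by (rule DERIV_chain2[OF G]) (use x in \<open>auto intro!: derivative_eq_intros\<close>)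
  moreover have "((\<lambda>u. phi_Phi_integral a (Phi_inv u)) has_real_derivative
      phi (Phi_inv x) * ?G x * (1 / phi (Phi_inv x))) (at x)"
    by (rule DERIV_chain2[OF phi_Phi_integral_has_derivative Phi_inv_has_derivative]) (use x in auto)
  moreover have "((\<lambda>u. 2 * u) has_real_derivative 2) (at x)"
    by (auto intro!: derivative_eq_intros)
  ultimately have "((\<lambda>u. 2 * u * ?G (u / 2) - 2 * phi_Phi_integral a (Phi_inv u)) has_real_derivative
      2 * ?G (x / 2) + ?G' (x / 2) * (1 / 2) * (2 * x)
        - 2 * (phi (Phi_inv x) * ?G x * (1 / phi (Phi_inv x)))) (at x)"
    by (intro DERIV_diff DERIV_mult DERIV_cmult)
  then have "(midpoint_error a has_real_derivative ?D) (at x)"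
    unfolding midpoint_error_def[abs_def] using phi_pos[of "Phi_inv x"]
    by (simp add: mult.commute)
  moreover have "0 \<le> ?D"
  proof -
    \<comment> \<open>For the mean value point \<open>z\<close> one has
      \<open>?D = x * (?G' (x/2) - ?G' z)\<close>, and the slope at \<open>z\<close> is the smaller
      one.\<close>
    have "\<exists>z>x/2. z < x \<and> ?G x - ?G (x/2) = (x - x/2) * ?G' z"
      by (rule MVT2, use x in simp, rule G) (use x in auto)
    then obtain z where z: "x/2 < z" "z < x" "?G x - ?G (x/2) = (x/2) * ?G' z"
      by auto
    have "Phi_inv (x/2) \<le> Phi_inv z" "Phi_inv z \<le> 0"
      using z x Phi_inv_less_iff[of "x/2" z] Phi_inv_nonpos[of z] by auto
    then have "(Phi_inv z)\<^sup>2 \<le> (Phi_inv (x/2))\<^sup>2"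
      by (simp add: abs_le_square_iff[symmetric])
    moreover have "a\<^sup>2 \<le> 1" using a by (simp add: power_le_one)
    ultimately have "?G' z \<le> ?G' (x/2)"
      using a by (auto intro!: mult_left_mono)
    then have "x * ?G' z \<le> x * ?G' (x/2)" by (rule mult_left_mono) (use x in auto)
    then show ?thesis using z(3) by simp
  qed
  ultimately show "\<exists>y. (midpoint_error a has_real_derivative y) (at x) \<and> 0 \<le> y" by blast
qed

text \<open>A negative value at \<open>u\<close> would, by monotonicity, bound the error away from 0
  at all smaller arguments, whereas at \<open>s\<close> the error is at least
  \<open>- 2 * s\<close>.\<close>

lemma midpoint_error_nonneg:
  assumes a: "0 \<le> a" "a \<le> 1" and u: "0 < u" "u \<le> 1/2"
  shows "0 \<le> midpoint_error a u"
proof (rule ccontr)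
  assume neg: "\<not> ?thesis"
  \<comment> \<open>The quarter makes \<open>- 2 * s\<close> at least half of the negative value,
    hence strictly above it.\<close>
  define s where "s = min u (- midpoint_error a u / 4)"
  have s: "0 < s" "s \<le> u" "s \<le> - midpoint_error a u / 4"
    using neg u by (auto simp: s_def)
  have "- 2 * s \<le> midpoint_error a s"
  proof -
    have "phi_Phi_integral a (Phi_inv s) \<le> s"
      using phi_Phi_integral_le[of a "Phi_inv s"] s u by (simp add: Phi_Phi_inv)
    moreover have "0 \<le> 2 * s * Phi (a * Phi_inv (s / 2))"
      using s by (simp add: Phi_nonneg)
    ultimately show ?thesis unfolding midpoint_error_def by linarith
  qed
  also have "\<dots> \<le> midpoint_error a u"
    by (rule midpoint_error_mono) (use a s u in auto)
  finally show False using s neg by linarith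
qed

section \<open>The copula and the error of the bound\<close>

abbreviation corr_ratio :: "real \<Rightarrow> real" where
  "corr_ratio \<rho> \<equiv> sqrt ((1 - \<rho>) / (1 + \<rho>))"

lemma corr_ratio_bounds:
  assumes "0 \<le> \<rho>" "\<rho> \<le> 1"
  shows "0 \<le> corr_ratio \<rho>" "corr_ratio \<rho> \<le> 1"
  using assms by (auto simp: real_sqrt_le_1_iff)

lemma bvn_copula_nondeg_diagonal:
  assumes "\<bar>\<rho>\<bar> < 1" "0 < u" "u < 1"
  shows "bvn_copula_nondeg u u \<rho> = 2 * phi_Phi_integral (corr_ratio \<rho>) (Phi_inv u)"
  using assms by (simp add: bvn_copula_nondeg_def Phi2_diagonal)

text \<open>\<open>Lim\<close> is determined only along a nontrivial filter, which holds because the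
  corner lies in the closure of the open square. The value follows by squeezing the copula between 0
  and its first argument.\<close>

lemma bvn_copula_nondeg_0:
  assumes "\<bar>\<rho>\<bar> < 1"
  shows "bvn_copula_nondeg 0 0 \<rho> = 0"
proof -
  let ?S = "{0<..<1::real} \<times> {0<..<1::real}"
  let ?F = "at (0::real, 0::real) within ?S"
  have "(0, 0) \<in> closure ?S" by (simp add: closure_Times)
  then have nontriv: "?F \<noteq> bot"
    unfolding trivial_limit_within by (simp add: closure_def)
  have in_S: "eventually (\<lambda>p. p \<in> ?S) ?F"
    by (simp add: eventually_at_filter)
  have "(fst \<longlongrightarrow> fst (0::real, 0::real)) ?F"
    by (intro tendsto_fst tendsto_ident_at)
  then have fst: "(fst \<longlongrightarrow> (0::real)) ?F" by simp
  have "((\<lambda>(s, t). Phi2 (Phi_inv s) (Phi_inv t) \<rho>) \<longlongrightarrow> 0) ?F"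
  proof (rule tendsto_sandwich[OF _ _ tendsto_const fst])
    show "eventually (\<lambda>p. 0 \<le> (case p of (s, t) \<Rightarrow> Phi2 (Phi_inv s) (Phi_inv t) \<rho>)) ?F"
      by (rule always_eventually) (simp add: split_beta Phi2_bounds assms)
    show "eventually (\<lambda>p. (case p of (s, t) \<Rightarrow> Phi2 (Phi_inv s) (Phi_inv t) \<rho>) \<le> fst p) ?F"
      using in_S
    proof eventually_elim
      case (elim p)
      then show ?case
        using Phi2_bounds(2)[OF assms, of "Phi_inv (fst p)"] by (auto simp: Phi_Phi_inv)
    qed
  qed
  then show ?thesis
    unfolding bvn_copula_nondeg_def using tendsto_Lim[OF nontriv] by simp
qed

lemma phi_Phi_integral_0: "phi_Phi_integral 0 h = Phi h / 2"
  using phi_Phi_integral_near_0[of 0 h] by simp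

lemma eventually_abs_less_1_at_left_1: "eventually (\<lambda>r. \<bar>r\<bar> < 1) (at_left (1::real))"
  using eventually_at_left_real[of 0 1] by (auto elim!: eventually_mono)

lemma bvn_copula_0:
  assumes "0 \<le> \<rho>" "\<rho> \<le> 1"
  shows "bvn_copula 0 0 \<rho> = 0"
proof (cases "\<rho> = 1")
  case True
  have "eventually (\<lambda>r. bvn_copula_nondeg 0 0 r = 0) (at_left 1)"
    using eventually_abs_less_1_at_left_1 by eventually_elim (rule bvn_copula_nondeg_0)
  then have "((\<lambda>r. bvn_copula_nondeg 0 0 r) \<longlongrightarrow> 0) (at_left 1)"
    by (rule tendsto_eventually)
  then show ?thesis using True by (simp add: bvn_copula_def tendsto_Lim)
qed (use assms in \<open>simp add: bvn_copula_def bvn_copula_nondeg_0\<close>)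

text \<open>At \<rho> = 1 the ratio is 0 and the right-hand side is \<open>u\<close>; that the
  defining limit agrees follows from the linear estimate in \<open>a\<close>, since the ratio tends
  to 0.\<close>

lemma bvn_copula_diagonal:
  assumes "0 \<le> \<rho>" "\<rho> \<le> 1" "0 < u" "u < 1"
  shows "bvn_copula u u \<rho> = 2 * phi_Phi_integral (corr_ratio \<rho>) (Phi_inv u)"
proof (cases "\<rho> = 1")
  case True
  define C where "C = (\<integral>x. phi x * \<bar>x\<bar> \<partial>lborel)"
  have "((\<lambda>r. \<bar>corr_ratio r\<bar> * C) \<longlongrightarrow> \<bar>corr_ratio 1\<bar> * C) (at_left 1)"
    by (intro tendsto_intros) auto
  then have lim0: "((\<lambda>r. \<bar>corr_ratio r\<bar> * C) \<longlongrightarrow> 0) (at_left 1)" by simp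
  have "((\<lambda>r. phi_Phi_integral (corr_ratio r) (Phi_inv u) - u / 2) \<longlongrightarrow> 0) (at_left 1)"
    by (rule Lim_null_comparison[OF always_eventually lim0])
       (use phi_Phi_integral_near_0[of _ "Phi_inv u"] assms in \<open>auto simp: C_def Phi_Phi_inv\<close>)
  then have "((\<lambda>r. 2 * (phi_Phi_integral (corr_ratio r) (Phi_inv u) - u / 2) + u) \<longlongrightarrow> 2 * 0 + u) (at_left 1)"
    by (intro tendsto_intros)
  moreover have "eventually (\<lambda>r. 2 * (phi_Phi_integral (corr_ratio r) (Phi_inv u) - u / 2) + u
      = bvn_copula_nondeg u u r) (at_left 1)"
    using eventually_abs_less_1_at_left_1
    by eventually_elim (use assms in \<open>simp add: bvn_copula_nondeg_diagonal\<close>)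
  ultimately have "((\<lambda>r. bvn_copula_nondeg u u r) \<longlongrightarrow> u) (at_left 1)"
    by (auto dest: Lim_transform_eventually)
  then show ?thesis
    using True assms by (simp add: bvn_copula_def tendsto_Lim phi_Phi_integral_0 Phi_Phi_inv)
qed (use assms in \<open>simp add: bvn_copula_def bvn_copula_nondeg_diagonal\<close>)

lemma bound_error_0: "0 \<le> \<rho> \<Longrightarrow> \<rho> \<le> 1 \<Longrightarrow> bound_error 0 \<rho> = 0"
  by (simp add: bound_error_def bvn_copula_0)

lemma bound_error_eq:
  assumes "0 \<le> \<rho>" "\<rho> \<le> 1" "0 < u" "u < 1"
  shows "bound_error u \<rho> = midpoint_error (corr_ratio \<rho>) u"
  using assms by (simp add: bound_error_def bvn_copula_diagonal midpoint_error_def bvn_g_def)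

lemma bound_error_nonneg:
  assumes "0 \<le> \<rho>" "\<rho> \<le> 1" "0 \<le> u" "u \<le> 1/2"
  shows "0 \<le> bound_error u \<rho>"
proof (cases "u = 0")
  case False
  then show ?thesis
    using assms corr_ratio_bounds[of \<rho>] by (simp add: bound_error_eq midpoint_error_nonneg)
qed (use assms in \<open>simp add: bound_error_0\<close>)

lemma bound_error_le_half:
  assumes "0 \<le> \<rho>" "\<rho> \<le> 1" "0 \<le> u" "u \<le> 1/2"
  shows "bound_error u \<rho> \<le> bound_error (1/2) \<rho>"
proof (cases "u = 0")
  case True
  then show ?thesis using assms bound_error_nonneg[of \<rho> "1/2"] by (simp add: bound_error_0)
next
  case False
  then show ?thesis
    using assms corr_ratio_bounds[of \<rho>] midpoint_error_mono[of "corr_ratio \<rho>" u "1/2"]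
    by (simp add: bound_error_eq)
qed

text \<open>For \<open>u > 0\<close>: \<rho> = 0 is \<open>a = 1\<close>, where bound and copula
  both equal \<open>u\<^sup>2\<close>; \<rho> = 1 is \<open>a = 0\<close>, where both equal
  \<open>u\<close>.\<close>

lemma bound_error_eq_0:
  assumes "0 \<le> \<rho>" "\<rho> \<le> 1" "0 \<le> u" "u \<le> 1/2" "\<rho> = 0 \<or> \<rho> = 1 \<or> u = 0"
  shows "bound_error u \<rho> = 0"
proof (cases "u = 0")
  case False
  then have "midpoint_error 0 u = 0" "midpoint_error 1 u = 0"
    using assms
    by (simp_all add: midpoint_error_def phi_Phi_integral_0 phi_Phi_integral_1 Phi_Phi_inv power2_eq_square)
  then show ?thesis using assms False by (auto simp: bound_error_eq)
qed (use assms in \<open>simp add: bound_error_0\<close>)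

section \<open>The error at u = 1/2 as a function of a\<close>

definition upper_quartile :: real where
  "upper_quartile = - Phi_inv (1/4)"

definition half_error :: "real \<Rightarrow> real" where
  "half_error a = 1/2 - Phi (a * upper_quartile) + arctan a / pi"

text \<open>At \<open>u = 1/2\<close> the quantile is 0, where the arctangent formula applies;
  reflecting \<open>Phi\<close> trades the lower for the upper quartile.\<close>

lemma bound_error_half:
  assumes "0 \<le> \<rho>" "\<rho> \<le> 1"
  shows "bound_error (1/2) \<rho> = half_error (corr_ratio \<rho>)"
  using assms Phi_minus[of "corr_ratio \<rho> * upper_quartile"]
  by (simp add: bound_error_eq midpoint_error_def phi_Phi_integral_at_0 half_error_def
      upper_quartile_def)

section \<open>Numerical bounds\<close>

text \<open>The Lagrange remainder has the sign of \<open>(- y) ^ N\<close>, so the parity of the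
  number of terms decides the direction of the estimate.\<close>

lemma exp_minus_series_upper:
  assumes "0 \<le> y" "odd N"
  shows "exp (- y) \<le> (\<Sum>n<N. (- y) ^ n / fact n :: real)"
proof -
  from Maclaurin_exp_le[of "- y" N] obtain t :: real
    where "exp (- y) = (\<Sum>n<N. (- y) ^ n / fact n) + (exp t / fact N) * (- y) ^ N" by blast
  moreover have "(- y) ^ N \<le> 0" using assms by (simp add: power_minus_odd)
  then have "(exp t / fact N) * (- y) ^ N \<le> 0" by (intro mult_nonneg_nonpos) auto
  ultimately show ?thesis by linarith
qed

lemma exp_minus_series_lower:
  assumes "even N"
  shows "(\<Sum>n<N. (- y) ^ n / fact n :: real) \<le> exp (- y)"
proof -
  from Maclaurin_exp_le[of "- y" N] obtain t :: real
    where "exp (- y) = (\<Sum>n<N. (- y) ^ n / fact n) + (exp t / fact N) * (- y) ^ N" by blast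
  moreover have "0 \<le> (exp t / fact N) * (- y) ^ N"
    by (intro mult_nonneg_nonneg zero_le_even_power assms) auto
  ultimately show ?thesis by linarith
qed

text \<open>The first \<open>N\<close> terms of the Taylor series of
  \<open>sqrt (2 * pi) * (Phi x - 1/2)\<close>; leaving the root outside keeps the coefficients
  rational.\<close>

definition Phi_series :: "nat \<Rightarrow> real \<Rightarrow> real" where
  "Phi_series N x = (\<Sum>n<N. (- 1 / 2) ^ n * x ^ (2 * n + 1) / (fact n * (2 * real n + 1)))"

lemma Phi_series_has_derivative:
  "(Phi_series N has_real_derivative (\<Sum>n<N. (- (x\<^sup>2 / 2)) ^ n / fact n)) (at x)"
proof -
  have "((\<lambda>x. (- 1 / 2) ^ n * x ^ (2 * n + 1) / (fact n * (2 * real n + 1))) has_real_derivative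
      (- (x\<^sup>2 / 2)) ^ n / fact n) (at x)" for n
  proof -
    have "(- (x\<^sup>2 / 2)) ^ n = (- 1 / 2) ^ n * x ^ (2 * n)"
    proof -
      have "- (x\<^sup>2 / 2) = (- 1 / 2) * x\<^sup>2" by simp
      then show ?thesis by (simp only: power_mult_distrib power_mult)
    qed
    moreover define c where "c = 2 * real n + 1"
    then have "c \<noteq> 0" by linarith
    moreover have "((\<lambda>x::real. x ^ (2 * n + 1)) has_real_derivative c * x ^ (2 * n)) (at x)"
      using DERIV_pow[of "2 * n + 1" x] by (simp add: c_def add.commute)
    from DERIV_cdivide[OF DERIV_cmult[OF this, of "(- 1 / 2) ^ n"], of "fact n * c"]
    have "((\<lambda>x. (- 1 / 2) ^ n * x ^ (2 * n + 1) / (fact n * c)) has_real_derivative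
      (- 1 / 2) ^ n * (c * x ^ (2 * n)) / (fact n * c)) (at x)" .
    ultimately show ?thesis
      unfolding c_def[symmetric] by simp
  qed
  note summand = this
  show ?thesis
    unfolding Phi_series_def[abs_def] by (rule DERIV_sum) (rule summand)
qed

lemma Phi_series_0 [simp]: "Phi_series N 0 = 0"
  by (simp add: Phi_series_def)

lemma sqrt_2pi_phi: "sqrt (2 * pi) * phi x = exp (- (x\<^sup>2 / 2))"
  by (simp add: std_normal_density_def)

text \<open>Both sides vanish at 0, and their derivatives are compared by the truncated exponential
  series.\<close>

lemma Phi_le_series:
  assumes "0 \<le> x" "odd N"
  shows "sqrt (2 * pi) * (Phi x - 1/2) \<le> Phi_series N x"
proof -
  let ?d = "\<lambda>x. Phi_series N x - sqrt (2 * pi) * (Phi x - 1/2)"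
  have "?d 0 \<le> ?d x"
  proof (rule DERIV_nonneg_imp_nondecreasing[OF assms(1)])
    fix z :: real
    have "(?d has_real_derivative (\<Sum>n<N. (- (z\<^sup>2 / 2)) ^ n / fact n) - sqrt (2 * pi) * phi z) (at z)"
      by (intro DERIV_diff DERIV_cmult Phi_series_has_derivative)
         (auto intro!: derivative_eq_intros)
    moreover have "0 \<le> (\<Sum>n<N. (- (z\<^sup>2 / 2)) ^ n / fact n) - sqrt (2 * pi) * phi z"
      unfolding sqrt_2pi_phi using exp_minus_series_upper[of "z\<^sup>2 / 2" N] assms by simp
    ultimately show "\<exists>y. (?d has_real_derivative y) (at z) \<and> 0 \<le> y" by blast
  qed
  then show ?thesis by simp
qed

lemma Phi_ge_series:
  assumes "0 \<le> x" "even N"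
  shows "Phi_series N x \<le> sqrt (2 * pi) * (Phi x - 1/2)"
proof -
  let ?d = "\<lambda>x. sqrt (2 * pi) * (Phi x - 1/2) - Phi_series N x"
  have "?d 0 \<le> ?d x"
  proof (rule DERIV_nonneg_imp_nondecreasing[OF assms(1)])
    fix z :: real
    have "(?d has_real_derivative sqrt (2 * pi) * phi z - (\<Sum>n<N. (- (z\<^sup>2 / 2)) ^ n / fact n)) (at z)"
      by (intro DERIV_diff DERIV_cmult Phi_series_has_derivative)
         (auto intro!: derivative_eq_intros)
    moreover have "0 \<le> sqrt (2 * pi) * phi z - (\<Sum>n<N. (- (z\<^sup>2 / 2)) ^ n / fact n)"
      unfolding sqrt_2pi_phi using exp_minus_series_lower[of N "z\<^sup>2 / 2"] assms by simp
    ultimately show "\<exists>y. (?d has_real_derivative y) (at z) \<and> 0 \<le> y" by blast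
  qed
  then show ?thesis by simp
qed

text \<open>The derivative of the difference is the geometric remainder
  \<open>z ^ 10 / (1 + z\<^sup>2)\<close>.\<close>

lemma arctan_le_poly:
  assumes "0 \<le> x"
  shows "arctan x \<le> x - x ^ 3 / 3 + x ^ 5 / 5 - x ^ 7 / 7 + x ^ 9 / 9"
proof -
  let ?d = "\<lambda>x. x - x ^ 3 / 3 + x ^ 5 / 5 - x ^ 7 / 7 + x ^ 9 / 9 - arctan x"
  have "?d 0 \<le> ?d x"
  proof (rule DERIV_nonneg_imp_nondecreasing[OF assms])
    fix z :: real
    have pos: "0 < 1 + z\<^sup>2" by (simp add: add_pos_nonneg)
    have "(?d has_real_derivative 1 - z\<^sup>2 + z ^ 4 - z ^ 6 + z ^ 8 - inverse (1 + z\<^sup>2)) (at z)"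
      by (auto intro!: derivative_eq_intros)
    moreover have "1 - z\<^sup>2 + z ^ 4 - z ^ 6 + z ^ 8 - inverse (1 + z\<^sup>2) = z ^ 10 / (1 + z\<^sup>2)"
      using pos by (simp add: divide_simps) (simp add: algebra_simps flip: power_add)
    ultimately have "(?d has_real_derivative z ^ 10 / (1 + z\<^sup>2)) (at z)" by (simp only:)
    moreover have "0 \<le> z ^ 10 / (1 + z\<^sup>2)" using pos by simp
    ultimately show "\<exists>y. (?d has_real_derivative y) (at z) \<and> 0 \<le> y" by blast
  qed
  then show ?thesis by simp
qed

lemma arctan_ge_poly:
  assumes "0 \<le> x"
  shows "x - x ^ 3 / 3 + x ^ 5 / 5 - x ^ 7 / 7 \<le> arctan x"
proof -
  let ?d = "\<lambda>x. arctan x - (x - x ^ 3 / 3 + x ^ 5 / 5 - x ^ 7 / 7)"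
  have "?d 0 \<le> ?d x"
  proof (rule DERIV_nonneg_imp_nondecreasing[OF assms])
    fix z :: real
    have pos: "0 < 1 + z\<^sup>2" by (simp add: add_pos_nonneg)
    have "(?d has_real_derivative inverse (1 + z\<^sup>2) - (1 - z\<^sup>2 + z ^ 4 - z ^ 6)) (at z)"
      by (auto intro!: derivative_eq_intros)
    moreover have "inverse (1 + z\<^sup>2) - (1 - z\<^sup>2 + z ^ 4 - z ^ 6) = z ^ 8 / (1 + z\<^sup>2)"
      using pos by (simp add: divide_simps) (simp add: algebra_simps flip: power_add)
    ultimately have "(?d has_real_derivative z ^ 8 / (1 + z\<^sup>2)) (at z)" by (simp only:)
    moreover have "0 \<le> z ^ 8 / (1 + z\<^sup>2)" using pos by simp
    ultimately show "\<exists>y. (?d has_real_derivative y) (at z) \<and> 0 \<le> y" by blast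
  qed
  then show ?thesis by simp
qed

lemma sqrt_2pi_bounds: "2.506628274 < sqrt (2 * pi)" "sqrt (2 * pi) < 2.506628275"
proof -
  show "2.506628274 < sqrt (2 * pi)"
    by (rule real_less_rsqrt) (use pi_approx in \<open>simp add: power2_eq_square\<close>)
  show "sqrt (2 * pi) < 2.506628275"
    by (rule real_less_lsqrt) (use pi_approx in \<open>simp_all add: power2_eq_square\<close>)
qed

lemma Phi_upper_quartile: "Phi upper_quartile = 3/4"
  unfolding upper_quartile_def by (simp add: Phi_minus Phi_Phi_inv)

lemma Phi_series_3: "Phi_series 3 x = x - x ^ 3 / 6 + x ^ 5 / 40"
  and Phi_series_4: "Phi_series 4 x = x - x ^ 3 / 6 + x ^ 5 / 40 - x ^ 7 / 336"
  and Phi_series_7: "Phi_series 7 x = x - x ^ 3 / 6 + x ^ 5 / 40 - x ^ 7 / 336 + x ^ 9 / 3456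
     - x ^ 11 / 42240 + x ^ 13 / 599040"
  and Phi_series_8: "Phi_series 8 x = x - x ^ 3 / 6 + x ^ 5 / 40 - x ^ 7 / 336 + x ^ 9 / 3456
     - x ^ 11 / 42240 + x ^ 13 / 599040 - x ^ 15 / 9676800"
  by (simp_all add: Phi_series_def lessThan_nat_numeral fact_numeral power_divide del: power_Suc)

text \<open>The target value is \<open>sqrt (2 * pi) / 4\<close>, because \<open>Phi\<close> is
  \<open>3/4\<close> at the quartile. An odd truncation bounds \<open>Phi\<close> from above and
  hence the quartile from below; an even one does the reverse.\<close>

lemma upper_quartile_bounds: "0.6744895 < upper_quartile" "upper_quartile < 0.67449"
proof -
  have "sqrt (2 * pi) * (Phi 0.6744895 - 1/2) \<le> Phi_series 7 0.6744895"
    by (rule Phi_le_series) auto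
  also have "\<dots> < 2.506628274 / 4"
    by (simp add: Phi_series_7 power_divide)
  also have "\<dots> < sqrt (2 * pi) / 4" using sqrt_2pi_bounds by simp
  finally have "sqrt (2 * pi) * (Phi 0.6744895 - 1/2) < sqrt (2 * pi) * (1/4)" by simp
  then have "Phi 0.6744895 < Phi upper_quartile"
    unfolding Phi_upper_quartile by (simp add: mult_less_cancel_left_pos)
  then show "0.6744895 < upper_quartile" by (simp add: strict_mono_less[OF strict_mono_Phi])
next
  have "sqrt (2 * pi) * (1/4) < 2.506628275 / 4" using sqrt_2pi_bounds by simp
  also have "\<dots> < Phi_series 8 0.67449"
    by (simp add: Phi_series_8 power_divide)
  also have "\<dots> \<le> sqrt (2 * pi) * (Phi 0.67449 - 1/2)"
    by (rule Phi_ge_series) auto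
  finally have "Phi upper_quartile < Phi 0.67449"
    unfolding Phi_upper_quartile by (simp add: mult_less_cancel_left_pos)
  then show "upper_quartile < 0.67449" by (simp add: strict_mono_less[OF strict_mono_Phi])
qed

section \<open>The critical equation\<close>

abbreviation "q \<equiv> upper_quartile"

text \<open>The variable \<open>s\<close> stands for \<open>a\<^sup>2\<close>, which unlike
  \<open>a\<close> is rational in \<rho>.\<close>

definition critical_fun :: "real \<Rightarrow> real" where
  "critical_fun s = (1 + s) * exp (- (s * q\<^sup>2 / 2))"

definition critical_value :: real where
  "critical_value = sqrt (2 * pi) / (pi * q)"

lemma q_pos: "0 < q"
  using upper_quartile_bounds by simp

text \<open>The logarithmic derivative \<open>1 / (1 + x) - q\<^sup>2 / 2\<close> is positive for
  \<open>0 \<le> x \<le> 1\<close> because \<open>q < 1\<close>.\<close>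

lemma critical_fun_strict_mono:
  assumes "0 \<le> s" "s < t" "t \<le> 1"
  shows "critical_fun s < critical_fun t"
proof (rule DERIV_pos_imp_increasing[OF assms(2)])
  fix x assume x: "s \<le> x" "x \<le> t"
  have "(critical_fun has_real_derivative exp (- (x * q\<^sup>2 / 2)) * (1 - (1 + x) * q\<^sup>2 / 2)) (at x)"
    unfolding critical_fun_def[abs_def]
    by (auto intro!: derivative_eq_intros simp: algebra_simps)
  moreover have "q\<^sup>2 < 1"
    using q_pos upper_quartile_bounds by (simp add: power_less_one_iff)
  then have "(1 + x) * q\<^sup>2 < 2 * 1"
    using x assms by (intro mult_le_less_imp_less) auto
  ultimately show "\<exists>y. (critical_fun has_real_derivative y) (at x) \<and> 0 < y"
    by (intro exI conjI) auto
qed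

lemma critical_fun_less_iff:
  "\<lbrakk>0 \<le> s; s \<le> 1; 0 \<le> t; t \<le> 1\<rbrakk> \<Longrightarrow> critical_fun s < critical_fun t \<longleftrightarrow> s < t"
  by (metis critical_fun_strict_mono less_asym less_linear)

lemma half_error_has_derivative:
  "(half_error has_real_derivative
     (critical_value - critical_fun (a\<^sup>2)) * q / (sqrt (2 * pi) * (1 + a\<^sup>2))) (at a)"
proof -
  have pos: "0 < 1 + a\<^sup>2" by (simp add: add_pos_nonneg)
  have "(half_error has_real_derivative - (phi (a * q) * q) + inverse (1 + a\<^sup>2) / pi) (at a)"
    unfolding half_error_def[abs_def] by (auto intro!: derivative_eq_intros)
  moreover have "phi (a * q) * q = critical_fun (a\<^sup>2) * q / (sqrt (2 * pi) * (1 + a\<^sup>2))"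
    using pos by (simp add: std_normal_density_def critical_fun_def power_mult_distrib)
  moreover have "inverse (1 + a\<^sup>2) / pi = critical_value * q / (sqrt (2 * pi) * (1 + a\<^sup>2))"
    using q_pos pos by (simp add: critical_value_def inverse_eq_divide)
  ultimately show ?thesis by (simp add: left_diff_distrib diff_divide_distrib)
qed

lemma half_error_le_critical:
  assumes "0 \<le> a0" "a0 \<le> 1" "critical_fun (a0\<^sup>2) = critical_value" "0 \<le> a" "a \<le> 1"
  shows "half_error a \<le> half_error a0"
proof -
  have pos: "0 < sqrt (2 * pi) * (1 + x\<^sup>2)" for x :: real
    by (intro mult_pos_pos) (auto simp: add_pos_nonneg)
  have le: "critical_fun (x\<^sup>2) \<le> critical_fun (y\<^sup>2)" if "0 \<le> x" "x \<le> y" "y \<le> 1" for x y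
  proof -
    have "x\<^sup>2 \<le> y\<^sup>2" "y\<^sup>2 \<le> 1" using that by (auto intro: power_mono power_le_one)
    then show ?thesis using critical_fun_less_iff[of "y\<^sup>2" "x\<^sup>2"] by fastforce
  qed
  show ?thesis
  proof (cases "a \<le> a0")
    case True
    show ?thesis
    proof (rule DERIV_nonneg_imp_nondecreasing[OF True])
      fix x assume "a \<le> x" "x \<le> a0"
      then have "0 \<le> (critical_value - critical_fun (x\<^sup>2)) * q / (sqrt (2 * pi) * (1 + x\<^sup>2))"
        using le[of x a0] assms q_pos pos[of x] by (intro divide_nonneg_pos mult_nonneg_nonneg) auto
      then show "\<exists>y. (half_error has_real_derivative y) (at x) \<and> 0 \<le> y"
        using half_error_has_derivative by blast
    qed
  next
    case False
    then have "a0 \<le> a" by simp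
    then show ?thesis
    proof (rule DERIV_nonpos_imp_nonincreasing)
      fix x assume "a0 \<le> x" "x \<le> a"
      then have "(critical_value - critical_fun (x\<^sup>2)) * q / (sqrt (2 * pi) * (1 + x\<^sup>2)) \<le> 0"
        using le[of a0 x] assms q_pos pos[of x] by (intro divide_nonpos_pos mult_nonpos_nonneg) auto
      then show "\<exists>y. (half_error has_real_derivative y) (at x) \<and> y \<le> 0"
        using half_error_has_derivative by blast
    qed
  qed
qed

text \<open>With \<open>1 + s = 2 / (1 + \<rho>)\<close>, both sides of the stated equation contain
  the positive factor \<open>(1 + \<rho>) / (2 * sqrt (2 * pi))\<close>, which cancels.\<close>

lemma critical_corr_iff:
  assumes "0 < \<rho>" "\<rho> \<le> 1"
  shows "critical_corr \<rho> \<longleftrightarrow> critical_fun ((1 - \<rho>) / (1 + \<rho>)) = critical_value"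
proof -
  let ?s = "(1 - \<rho>) / (1 + \<rho>)"
  have s: "0 \<le> ?s" using assms by simp
  have "1 + ?s = 2 / (1 + \<rho>)" using assms by (simp add: field_simps)
  moreover have "phi (corr_ratio \<rho> * Phi_inv (1/4)) = exp (- (?s * q\<^sup>2 / 2)) / sqrt (2 * pi)"
    using s by (simp add: std_normal_density_def power_mult_distrib upper_quartile_def)
  ultimately have phi_eq: "phi (corr_ratio \<rho> * Phi_inv (1/4))
      = critical_fun ?s * ((1 + \<rho>) / (2 * sqrt (2 * pi)))"
    using assms by (simp add: critical_fun_def)
  have "- ((1 + \<rho>) / (2 * pi * Phi_inv (1/4))) = (1 + \<rho>) / (2 * pi * q)"
    by (simp add: upper_quartile_def)
  also have "\<dots> = critical_value * ((1 + \<rho>) / (2 * sqrt (2 * pi)))"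
    using q_pos by (simp add: critical_value_def)
  finally show ?thesis
    unfolding critical_corr_def phi_eq using assms by auto
qed

section \<open>Enclosing the critical correlation and the maximal error\<close>

lemma critical_fun_less_critical_value: "critical_fun ((1 - 0.5962) / (1 + 0.5962)) < critical_value"
proof -
  \<comment> \<open>All roundings go one way: the lower bound of \<open>q\<close> and an odd
    truncation overestimate the exponential, while the upper bounds of \<open>pi\<close> and
    \<open>q\<close> underestimate \<open>critical_value\<close>.\<close>
  let ?s = "(1 - 0.5962) / (1 + 0.5962) :: real"
  let ?y = "?s * 0.6744895\<^sup>2 / 2 :: real"
  have "0.6744895\<^sup>2 \<le> q\<^sup>2" using upper_quartile_bounds by (intro power_mono) auto
  then have "exp (- (?s * q\<^sup>2 / 2)) \<le> exp (- ?y)" by simp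
  also have "\<dots> \<le> (\<Sum>n<5. (- ?y) ^ n / fact n)"
    by (rule exp_minus_series_upper) auto
  finally have e: "exp (- (?s * q\<^sup>2 / 2)) \<le> (\<Sum>n<5. (- ?y) ^ n / fact n)" .
  have "critical_fun ?s \<le> (1 + ?s) * (\<Sum>n<5. (- ?y) ^ n / fact n)"
    unfolding critical_fun_def by (rule mult_left_mono[OF e]) simp
  also have "\<dots> < 2.506628274 / (3.1415926535899 * 0.67449)"
    by (simp add: lessThan_nat_numeral fact_numeral power_divide power_mult_distrib)
  also have "\<dots> \<le> critical_value"
    unfolding critical_value_def using sqrt_2pi_bounds upper_quartile_bounds pi_approx
    by (intro frac_le mult_mono) auto
  finally show ?thesis .
qed

lemma critical_value_less_critical_fun: "critical_value < critical_fun ((1 - 0.5961) / (1 + 0.5961))"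
proof -
  let ?s = "(1 - 0.5961) / (1 + 0.5961) :: real"
  let ?y = "?s * 0.67449\<^sup>2 / 2 :: real"
  have "critical_value \<le> 2.506628275 / (3.141592653588 * 0.6744895)"
    unfolding critical_value_def using sqrt_2pi_bounds upper_quartile_bounds pi_approx
    by (intro frac_le mult_mono) auto
  also have "\<dots> < (1 + ?s) * (\<Sum>n<4. (- ?y) ^ n / fact n)"
    by (simp add: lessThan_nat_numeral fact_numeral power_divide power_mult_distrib)
  also have "\<dots> \<le> critical_fun ?s"
  proof -
    have "q\<^sup>2 \<le> 0.67449\<^sup>2" using upper_quartile_bounds q_pos by (intro power_mono) auto
    then have "exp (- ?y) \<le> exp (- (?s * q\<^sup>2 / 2))" by simp
    moreover have "(\<Sum>n<4. (- ?y) ^ n / fact n) \<le> exp (- ?y)"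
      by (rule exp_minus_series_lower) auto
    ultimately have "(\<Sum>n<4. (- ?y) ^ n / fact n) \<le> exp (- (?s * q\<^sup>2 / 2))" by linarith
    then show ?thesis unfolding critical_fun_def by (rule mult_left_mono) simp
  qed
  finally show ?thesis .
qed

text \<open>Any point bounds the maximum from below; \<open>1/2\<close> is a simple rational close
  to the maximizer, which is about 0.503. The constant \<open>0.337245\<close> is half the upper
  bound of \<open>q\<close>.\<close>

lemma half_error_lower: "0.015 \<le> half_error (1/2)"
proof -
  have "sqrt (2 * pi) * (Phi 0.337245 - 1/2) \<le> Phi_series 3 0.337245"
    by (rule Phi_le_series) auto
  also have "\<dots> \<le> 2.506628274 * 0.13206"
    by (simp add: Phi_series_3 power_divide)
  also have "\<dots> \<le> sqrt (2 * pi) * 0.13206"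
    using sqrt_2pi_bounds by simp
  finally have "Phi 0.337245 - 1/2 \<le> 0.13206"
    by (simp add: mult_le_cancel_left_pos)
  moreover have "Phi (1/2 * q) \<le> Phi 0.337245"
    using upper_quartile_bounds by (simp add: strict_mono_less_eq[OF strict_mono_Phi])
  moreover have "0.1473 \<le> arctan (1/2) / pi"
  proof -
    have "0.1473 * pi \<le> 0.4633" using pi_approx by simp
    also have "\<dots> \<le> arctan (1/2)" using arctan_ge_poly[of "1/2"] by (simp add: power_divide)
    finally show ?thesis by (simp add: field_simps)
  qed
  ultimately show ?thesis unfolding half_error_def by simp
qed

text \<open>The interval encloses the maximizer, as it contains the ratios belonging to correlations
  between 0.5961 and 0.5962. The two monotone terms are estimated at opposite ends,
  \<open>Phi\<close> at the left and \<open>arctan\<close> at the right; \<open>0.3392\<close> is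
  \<open>0.5029 * 0.6744895\<close> rounded down.\<close>

lemma half_error_upper:
  assumes "0.5029 \<le> a" "a \<le> 0.5031"
  shows "half_error a < 0.016"
proof -
  have "sqrt (2 * pi) * 0.1327 \<le> 2.506628275 * 0.1327"
    using sqrt_2pi_bounds by simp
  also have "\<dots> \<le> Phi_series 4 0.3392"
    by (simp add: Phi_series_4 power_divide)
  also have "\<dots> \<le> sqrt (2 * pi) * (Phi 0.3392 - 1/2)"
    by (rule Phi_ge_series) auto
  finally have "0.1327 \<le> Phi 0.3392 - 1/2"
    by (simp add: mult_le_cancel_left_pos)
  moreover have "0.5029 * 0.6744895 \<le> a * q"
    using assms upper_quartile_bounds by (intro mult_mono) auto
  then have "Phi 0.3392 \<le> Phi (a * q)"
    by (simp add: strict_mono_less_eq[OF strict_mono_Phi])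
  moreover have "arctan a / pi \<le> 0.1485"
  proof -
    have "arctan a \<le> arctan 0.5031" using assms by (simp add: arctan_le_iff)
    also have "\<dots> \<le> 0.4663" using arctan_le_poly[of "0.5031"] by (simp add: power_divide)
    also have "\<dots> \<le> 0.1485 * pi" using pi_approx by simp
    finally show ?thesis by (simp add: field_simps)
  qed
  ultimately show ?thesis unfolding half_error_def by simp
qed

lemma critical_fun_root:
  obtains s0 where "(1 - 0.5962) / (1 + 0.5962) < s0" "s0 < (1 - 0.5961) / (1 + 0.5961)"
    "critical_fun s0 = critical_value"
proof -
  have "continuous_on {(1 - 0.5962) / (1 + 0.5962) .. (1 - 0.5961) / (1 + 0.5961)} critical_fun"
    unfolding critical_fun_def[abs_def] by (intro continuous_intros) auto
  then obtain s0 where "(1 - 0.5962) / (1 + 0.5962) \<le> s0" "s0 \<le> (1 - 0.5961) / (1 + 0.5961)"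
    "critical_fun s0 = critical_value"
    using IVT'[of critical_fun "(1 - 0.5962) / (1 + 0.5962)" critical_value "(1 - 0.5961) / (1 + 0.5961)"]
      critical_fun_less_critical_value critical_value_less_critical_fun by force
  \<comment> \<open>Excluding the end points yields the strict bound
    \<open>\<rho>0 < 0.5962\<close>.\<close>
  moreover from this have "s0 \<noteq> (1 - 0.5962) / (1 + 0.5962)" "s0 \<noteq> (1 - 0.5961) / (1 + 0.5961)"
    by (metis critical_fun_less_critical_value order_less_irrefl) (metis critical_value_less_critical_fun order_less_irrefl calculation(3))
  ultimately show thesis by (intro that[of s0]) auto
qed

theorem theorem5p3:
  shows "(\<forall>\<rho> u :: real. 0 < \<rho> \<and> \<rho> \<le> 1 \<and> 0 \<le> u \<and> u \<le> 1/2 \<longrightarrow>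
            bvn_copula u u \<rho> \<le> 2 * u * bvn_g (u / 2) \<rho>)
       \<and> (\<forall>\<rho> u :: real. 0 \<le> \<rho> \<and> \<rho> \<le> 1 \<and> 0 \<le> u \<and> u \<le> 1/2 \<and> (\<rho> = 0 \<or> \<rho> = 1 \<or> u = 0) \<longrightarrow>
            bvn_copula u u \<rho> = 2 * u * bvn_g (u / 2) \<rho>)
       \<and> (\<exists>\<rho>\<^sub>0 :: real. 0 < \<rho>\<^sub>0 \<and> \<rho>\<^sub>0 \<le> 1 \<and> critical_corr \<rho>\<^sub>0
            \<and> (\<forall>\<rho>. 0 < \<rho> \<and> \<rho> \<le> 1 \<and> critical_corr \<rho> \<longrightarrow> \<rho> = \<rho>\<^sub>0)
            \<and> 0.5961 \<le> \<rho>\<^sub>0 \<and> \<rho>\<^sub>0 < 0.5962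
            \<and> (\<forall>\<rho> u. 0 < \<rho> \<and> \<rho> \<le> 1 \<and> 0 \<le> u \<and> u \<le> 1/2 \<longrightarrow>
                 bound_error u \<rho> \<le> bound_error (1/2) \<rho>\<^sub>0)
            \<and> 0.015 \<le> bound_error (1/2) \<rho>\<^sub>0 \<and> bound_error (1/2) \<rho>\<^sub>0 < 0.016)"
proof (intro conjI)
  show "\<forall>\<rho> u :: real. 0 < \<rho> \<and> \<rho> \<le> 1 \<and> 0 \<le> u \<and> u \<le> 1/2 \<longrightarrow>
            bvn_copula u u \<rho> \<le> 2 * u * bvn_g (u / 2) \<rho>"
    using bound_error_nonneg by (simp add: bound_error_def)
  show "\<forall>\<rho> u :: real. 0 \<le> \<rho> \<and> \<rho> \<le> 1 \<and> 0 \<le> u \<and> u \<le> 1/2 \<and> (\<rho> = 0 \<or> \<rho> = 1 \<or> u = 0) \<longrightarrow>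
            bvn_copula u u \<rho> = 2 * u * bvn_g (u / 2) \<rho>"
    using bound_error_eq_0 by (simp add: bound_error_def)
next
  obtain s0 where s0: "(1 - 0.5962) / (1 + 0.5962) < s0" "s0 < (1 - 0.5961) / (1 + 0.5961)"
    "critical_fun s0 = critical_value"
    by (rule critical_fun_root)
  \<comment> \<open>The map from \<rho> to \<open>s\<close> is an order-reversing involution, so the
    same formula inverts it and the ends of the bracket change places.\<close>
  define \<rho>0 where "\<rho>0 = (1 - s0) / (1 + s0)"
  have s0_bounds: "0 < s0" "s0 < 1" "0.5029\<^sup>2 \<le> s0" "s0 \<le> 0.5031\<^sup>2"
    using s0 by (simp_all add: power2_eq_square)
  have sqrt_s0: "0.5029 \<le> sqrt s0" "sqrt s0 \<le> 0.5031"
    by (rule real_le_rsqrt real_le_lsqrt; use s0_bounds in simp)+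
  have s0_eq: "(1 - \<rho>0) / (1 + \<rho>0) = s0"
    using s0_bounds by (simp add: \<rho>0_def field_simps)
  have \<rho>0: "0.5961 < \<rho>0" "\<rho>0 < 0.5962"
    using s0 by (simp_all add: \<rho>0_def field_simps)
  have err0: "bound_error (1/2) \<rho>0 = half_error (sqrt s0)"
    using bound_error_half[of \<rho>0] \<rho>0 by (simp add: s0_eq)
  have max: "half_error a \<le> half_error (sqrt s0)" if "0 \<le> a" "a \<le> 1" for a
    by (rule half_error_le_critical) (use that s0 s0_bounds in auto)
  have "critical_corr \<rho>0"
    using critical_corr_iff[of \<rho>0] \<rho>0 s0 by (simp add: s0_eq)
  moreover have "\<rho> = \<rho>0" if "0 < \<rho> \<and> \<rho> \<le> 1 \<and> critical_corr \<rho>" for \<rho>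
  proof -
    let ?s = "(1 - \<rho>) / (1 + \<rho>)"
    have "critical_fun ?s = critical_fun s0" using critical_corr_iff[of \<rho>] that s0 by simp
    moreover have "0 \<le> ?s" "?s \<le> 1" using that by (auto simp: field_simps)
    ultimately have "?s = s0"
      using critical_fun_less_iff[of ?s s0] critical_fun_less_iff[of s0 ?s] s0_bounds by simp
    then show ?thesis using that s0_bounds by (auto simp: \<rho>0_def field_simps)
  qed
  moreover have "bound_error u \<rho> \<le> bound_error (1/2) \<rho>0"
    if "0 < \<rho> \<and> \<rho> \<le> 1 \<and> 0 \<le> u \<and> u \<le> 1/2" for \<rho> u
  proof -
    have "bound_error u \<rho> \<le> bound_error (1/2) \<rho>" using that by (intro bound_error_le_half) auto
    also have "\<dots> = half_error (corr_ratio \<rho>)" using that by (intro bound_error_half) auto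
    also have "\<dots> \<le> bound_error (1/2) \<rho>0"
      unfolding err0 using that by (intro max corr_ratio_bounds) auto
    finally show ?thesis .
  qed
  moreover have "0.015 \<le> bound_error (1/2) \<rho>0"
    unfolding err0 using half_error_lower max[of "1/2"] by linarith
  moreover have "bound_error (1/2) \<rho>0 < 0.016"
    unfolding err0
    by (rule half_error_upper) (fact sqrt_s0)+
  ultimately show "\<exists>\<rho>\<^sub>0 :: real. 0 < \<rho>\<^sub>0 \<and> \<rho>\<^sub>0 \<le> 1 \<and> critical_corr \<rho>\<^sub>0
            \<and> (\<forall>\<rho>. 0 < \<rho> \<and> \<rho> \<le> 1 \<and> critical_corr \<rho> \<longrightarrow> \<rho> = \<rho>\<^sub>0)
            \<and> 0.5961 \<le> \<rho>\<^sub>0 \<and> \<rho>\<^sub>0 < 0.5962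
            \<and> (\<forall>\<rho> u. 0 < \<rho> \<and> \<rho> \<le> 1 \<and> 0 \<le> u \<and> u \<le> 1/2 \<longrightarrow>
                 bound_error u \<rho> \<le> bound_error (1/2) \<rho>\<^sub>0)
            \<and> 0.015 \<le> bound_error (1/2) \<rho>\<^sub>0 \<and> bound_error (1/2) \<rho>\<^sub>0 < 0.016"
    using \<rho>0 by (intro exI[of _ \<rho>0]) auto
qed

end
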